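(* Let $n\in\mathbb{N}$, $n\ge1$. If Conjecture C holds for $n-1$ and the Lonely Vector Property holds for every natural number at most $n$, then every Strong Lonely Runner Zonotope $Z_{\mathbf v}\subseteq\mathbb{R}^{n-1}$ that violates Conjecture C for $n$, i.e. with $\mu(Z_{\mathbf v})>\frac{n-1}{n+1}$, contains at most $\binom{n+1}{2}^{n-1}$ points of $\mathbb{Z}^{n-1}$.
   Context: The covering radius of a convex body $M\subseteq\mathbb{R}^d$ is $\mu(M)=\min\{\rho>0:\rho M+\mathbb{Z}^d=\mathbb{R}^d\}$. For $\mathbf v=(v_1,\dots,v_m)\in\mathbb{Z}_{>0}^m$ with $\gcd(v_1,\dots,v_m)=1$, choose $\mathbf u_1,\dots,\mathbf u_m\in\mathbb{Z}^{m-1}$ that generate $\mathbb{Z}^{m-1}$ as a lattice and satisfy $\sum_{i=1}^m v_i\mathbf u_i=\mathbf 0$, and put $Z_{\mathbf v}=\sum_{i=1}^m[\mathbf 0,\mathbf u_i]\subseteq\mathbb{R}^{m-1}$; it is unique up to unimodular equivalence. $Z_{\mathbf v}$ is called a Strong Lonely Runner Zonotope (sLRZ) when the entries of $\mathbf v$ are pairwise distinct. "Conjecture C holds for $m$" (the zonotopal form of the shifted Lonely Runner Conjecture) means: every sLRZ $Z_{\mathbf v}$ of dimension $m-1$ satisfies $\mu(Z_{\mathbf v})\le\frac{m-1}{m+1}$ (vacuous for $m=0$). Lonely Vector Property (LVP): for a set $\mathbf P=\{\mathbf p_1,\dots,\mathbf p_k\}\subseteq\mathbb{R}^2$ of $k$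 non-zero vectors, not all parallel and no two equal or opposite to one another, let $S_{\mathbf P}$ be the multiset of cardinality $k^2$ given by $$S_{\mathbf P}=\mathbf P\cup\{\mathbf p_i+\mathbf p_j:1\le i<j\le k\}\cup\{\mathbf p_i-\mathbf p_j:1\le i<j\le k\}.$$ The set $\mathbf P$ satisfies the LVP if $S_{\mathbf P}$ contains a vector that is not parallel to any other vector in the multiset $S_{\mathbf P}$. The LVP holds for a natural number $k$ if every set of $k$ non-zero vectors in $\mathbb{Q}^2$, not all parallel and no two equal or opposite, satisfies the LVP. *)

theory Defs
  imports
    "Jordan_Normal_Form.Matrix"
    "HOL-Analysis.Product_Vector"
    "HOL-Library.Multiset"
begin

section \<open>Lattice points and covering radius\<close>

text \<open>The dimension varies inside the statements below, so \<open>\<real>\<^sup>d\<close> is \<open>carrier_vec d\<close>.\<close>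

definition int_points :: "nat \<Rightarrow> real vec set" where
  "int_points d = {x \<in> carrier_vec d. \<forall>i<d. x $ i \<in> \<int>}"

text \<open>The infimum is the minimum whenever the latter exists (lemma below), in particular for
  every full-dimensional convex body with \<open>d > 0\<close>. In dimension \<open>0\<close> every \<open>\<rho> > 0\<close> is admissible
  and the infimum gives the value \<open>0\<close>.\<close>

definition covering_radius :: "nat \<Rightarrow> real vec set \<Rightarrow> real" where
  "covering_radius d M =
     Inf {\<rho>. \<rho> > 0 \<and> {\<rho> \<cdot>\<^sub>v x + z | x z. x \<in> M \<and> z \<in> int_points d} = carrier_vec d}"

lemma covering_radius_eq_minimum:
  assumes "\<rho> > 0"
    and "{\<rho> \<cdot>\<^sub>v x + z | x z. x \<in> M \<and> z \<in> int_points d} = carrier_vec d"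
    and "\<And>\<sigma>. \<sigma> > 0 \<Longrightarrow> {\<sigma> \<cdot>\<^sub>v x + z | x z. x \<in> M \<and> z \<in> int_points d} = carrier_vec d \<Longrightarrow> \<rho> \<le> \<sigma>"
  shows "covering_radius d M = \<rho>"
  unfolding covering_radius_def by (rule cInf_eq_minimum) (use assms in blast)+

section \<open>Lonely Runner Zonotopes\<close>

text \<open>The columns of \<open>U\<close> are the vectors \<open>u\<^sub>1, \<dots>, u\<^sub>m\<close>. Hence \<open>U *\<^sub>v c\<close> is the linear
  combination \<open>c\<^sub>1 u\<^sub>1 + \<dots> + c\<^sub>m u\<^sub>m\<close>, and the Minkowski sum of the segments \<open>[0, u\<^sub>i]\<close>
  is the set of those combinations with coefficients in \<open>[0, 1]\<close>.\<close>

definition zonotope :: "int mat \<Rightarrow> real vec set" where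
  "zonotope U = {map_mat real_of_int U *\<^sub>v t | t.
     t \<in> carrier_vec (dim_col U) \<and> (\<forall>i<dim_col U. 0 \<le> t $ i \<and> t $ i \<le> 1)}"

text \<open>The set equation says that the columns of \<open>U\<close> generate \<open>\<int>\<^bsup>m-1\<^esup>\<close> as a lattice. The gcd condition
  excludes \<open>m = 0\<close>, so the truncated subtraction is harmless.\<close>

definition LR_generators :: "nat \<Rightarrow> int vec \<Rightarrow> int mat \<Rightarrow> bool" where
  "LR_generators m v U \<longleftrightarrow>
     v \<in> carrier_vec m \<and> (\<forall>i<m. v $ i > 0) \<and> Gcd {v $ i | i. i < m} = 1 \<and>
     U \<in> carrier_mat (m - 1) m \<and>
     {U *\<^sub>v c | c. c \<in> carrier_vec m} = carrier_vec (m - 1) \<and>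
     U *\<^sub>v v = 0\<^sub>v (m - 1)"

text \<open>All choices of generators for the given \<open>v\<close> are allowed; the resulting zonotopes are
  unimodularly equivalent.\<close>

definition strong_LR_zonotope :: "nat \<Rightarrow> real vec set \<Rightarrow> bool" where
  "strong_LR_zonotope m Z \<longleftrightarrow>
     (\<exists>v U. LR_generators m v U \<and> inj_on (\<lambda>i. v $ i) {..<m} \<and> Z = zonotope U)"

definition conjecture_C :: "nat \<Rightarrow> bool" where
  "conjecture_C m \<longleftrightarrow>
     (\<forall>Z. strong_LR_zonotope m Z \<longrightarrow>
        covering_radius (m - 1) Z \<le> (real m - 1) / (real m + 1))"

lemma conjecture_C_0: "conjecture_C 0"
  by (simp add: conjecture_C_def strong_LR_zonotope_def LR_generators_def)

section \<open>The Lonely Vector Property\<close>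

definition parallel :: "real \<times> real \<Rightarrow> real \<times> real \<Rightarrow> bool" where
  "parallel x y \<longleftrightarrow> (\<exists>c. y = c *\<^sub>R x) \<or> (\<exists>c. x = c *\<^sub>R y)"

text \<open>A set \<open>{p\<^sub>1, \<dots>, p\<^sub>k}\<close> is given by an enumeration \<open>p\<close>, because the differences
  \<open>p\<^sub>i - p\<^sub>j\<close> with \<open>i < j\<close> depend, up to sign, on the chosen order.\<close>

definition LV_admissible :: "(real \<times> real) list \<Rightarrow> bool" where
  "LV_admissible p \<longleftrightarrow>
     (\<forall>i<length p. p ! i \<noteq> 0) \<and>
     \<not> (\<forall>i<length p. \<forall>j<length p. parallel (p ! i) (p ! j)) \<and>
     (\<forall>i j. i < j \<and> j < length p \<longrightarrow> p ! i \<noteq> p ! j \<and> p ! i \<noteq> - (p ! j))"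

definition LV_multiset :: "(real \<times> real) list \<Rightarrow> (real \<times> real) multiset" where
  "LV_multiset p =
     mset p +
     {# p ! i + p ! j. (i, j) \<in># mset_set {(i, j). i < j \<and> j < length p} #} +
     {# p ! i - p ! j. (i, j) \<in># mset_set {(i, j). i < j \<and> j < length p} #}"

text \<open>Removing one copy of \<open>x\<close> before comparing accounts for multiplicities: a vector that
  occurs twice is parallel to its other copy.\<close>

definition LV_property :: "(real \<times> real) list \<Rightarrow> bool" where
  "LV_property p \<longleftrightarrow>
     (\<exists>x \<in># LV_multiset p. \<forall>y \<in># LV_multiset p - {#x#}. \<not> parallel x y)"

definition LVP :: "nat \<Rightarrow> bool" where
  "LVP k \<longleftrightarrow>
     (\<forall>p. length p = k \<and> set p \<subseteq> \<rat> \<times> \<rat> \<and> LV_admissible p \<longrightarrow> LV_property p)"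

end

theory Submission
  imports Defs "HOL-Library.FuncSet"
begin

text \<open>Let \<open>N = n (n + 1) / 2\<close>. If \<open>Z\<close> has more than \<open>N\<^bsup>n-1\<^esup>\<close> lattice points, two of them are congruent modulo
  \<open>N\<close>, so \<open>Z\<close> contains a segment \<open>N z\<close> with a nonzero lattice vector \<open>z = U w\<close>. The vectors
  \<open>p\<^sub>i = (v\<^sub>i, w\<^sub>i)\<close> are admissible, and a lonely vector \<open>s\<close> gives the relation \<open>\<lambda>\<^sub>l = det(s, p\<^sub>l)\<close>
  of the generators modulo \<open>z\<close>. After dropping one generator (if \<open>s = p\<^sub>j\<close>) or replacing two generators by a diagonal of
  the parallelogram they span (if \<open>s = p\<^sub>i \<plusminus> p\<^sub>j\<close>), the remaining \<open>n - 1\<close> coefficients are nonzero with distinct absolute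
  values. So \<open>Z\<close> modulo \<open>z\<close> contains a strong Lonely Runner Zonotope with respect to a possibly coarser lattice, and
  \<open>\<mu>(Z) \<le> (n - 2) / n + 1 / N = (n - 1) / (n + 1)\<close>.\<close>

section \<open>Zonotopes and covering radii in coordinates\<close>

lemma mult_mat_vec_index_sum:
  assumes "A \<in> carrier_mat d m" "t \<in> carrier_vec m" "r < d"
  shows "(A *\<^sub>v t) $ r = (\<Sum>i<m. A $$ (r, i) * t $ i)"
  using assms by (auto simp: scalar_prod_def lessThan_atLeast0 intro!: sum.cong)

text \<open>Replaces vectors by functions on indices and finite sums, the form in which all later
  arguments run; integral real coordinates become integers by taking floors.\<close>

lemma translates_cover_iff:
  assumes U: "U \<in> carrier_mat d m"
  shows "{\<rho> \<cdot>\<^sub>v x + z | x z. x \<in> zonotope U \<and> z \<in> int_points d} = carrier_vec d \<longleftrightarrow>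
    (\<forall>y. \<exists>t z. (\<forall>i<m. 0 \<le> t i \<and> t i \<le> 1) \<and>
       (\<forall>r<d. y r = \<rho> * (\<Sum>i<m. real_of_int (U $$ (r, i)) * t i) + real_of_int (z r)))"
    (is "?L = _ \<longleftrightarrow> ?R")
proof -
  have RU: "map_mat real_of_int U \<in> carrier_mat d m" using U by auto
  have idx: "(map_mat real_of_int U *\<^sub>v t) $ r = (\<Sum>i<m. real_of_int (U $$ (r, i)) * t $ i)"
    if "t \<in> carrier_vec m" "r < d" for t r
    using mult_mat_vec_index_sum[OF RU that] U that by (auto intro!: sum.cong)
  have sub: "?L \<subseteq> carrier_vec d"
    using U by (auto simp: zonotope_def int_points_def)
  have "carrier_vec d \<subseteq> ?L \<longleftrightarrow> ?R"
  proof
    assume H: "carrier_vec d \<subseteq> ?L"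
    show ?R
    proof
      fix y :: "nat \<Rightarrow> real"
      have "vec d y \<in> ?L" using H vec_carrier by blast
      then obtain t z where t: "t \<in> carrier_vec m" "\<forall>i<m. 0 \<le> t $ i \<and> t $ i \<le> 1"
        and z: "z \<in> int_points d"
        and e: "vec d y = \<rho> \<cdot>\<^sub>v (map_mat real_of_int U *\<^sub>v t) + z"
        using U by (auto simp: zonotope_def)
      have "y r = \<rho> * (\<Sum>i<m. real_of_int (U $$ (r, i)) * t $ i) + real_of_int \<lfloor>z $ r\<rfloor>" if "r < d" for r
      proof -
        have "vec d y $ r = (\<rho> \<cdot>\<^sub>v (map_mat real_of_int U *\<^sub>v t) + z) $ r" using e by simp
        moreover have "z $ r = real_of_int \<lfloor>z $ r\<rfloor>" using z that by (auto simp: int_points_def Ints_def)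
        ultimately show ?thesis using z that U idx[OF t(1) that] by (auto simp: int_points_def)
      qed
      then show "\<exists>t z. (\<forall>i<m. 0 \<le> t i \<and> t i \<le> 1) \<and>
       (\<forall>r<d. y r = \<rho> * (\<Sum>i<m. real_of_int (U $$ (r, i)) * t i) + real_of_int (z r))"
        using t(2) by (intro exI[of _ "\<lambda>i. t $ i"] exI[of _ "\<lambda>r. \<lfloor>z $ r\<rfloor>"]) auto
    qed
  next
    assume H: ?R
    show "carrier_vec d \<subseteq> ?L"
    proof
      fix y :: "real vec" assume y: "y \<in> carrier_vec d"
      obtain t z where t: "\<forall>i<m. 0 \<le> t i \<and> t i \<le> 1"
        and e: "\<forall>r<d. y $ r = \<rho> * (\<Sum>i<m. real_of_int (U $$ (r, i)) * t i) + real_of_int (z r)"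
        using spec[OF H, of "\<lambda>r. y $ r"] by blast
      have "y = \<rho> \<cdot>\<^sub>v (map_mat real_of_int U *\<^sub>v vec m t) + vec d (\<lambda>r. real_of_int (z r))"
        using y U e idx[of "vec m t"] by (intro eq_vecI) auto
      moreover have "map_mat real_of_int U *\<^sub>v vec m t \<in> zonotope U"
        unfolding zonotope_def using U t by (auto intro!: exI[of _ "vec m t"])
      moreover have "vec d (\<lambda>r. real_of_int (z r)) \<in> int_points d"
        by (auto simp: int_points_def)
      ultimately show "y \<in> ?L" by blast
    qed
  qed
  then show ?thesis using sub by (simp only: set_eq_subset simp_thms)
qed

lemma covering_radius_le:
  assumes "\<rho> > 0" "{\<rho> \<cdot>\<^sub>v x + z | x z. x \<in> M \<and> z \<in> int_points d} = carrier_vec d"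
  shows "covering_radius d M \<le> \<rho>"
  unfolding covering_radius_def
  by (rule cInf_lower) (use assms in \<open>auto intro!: bdd_belowI[of _ 0]\<close>)

lemma int_mat_surjD:
  assumes "U \<in> carrier_mat d m" "{U *\<^sub>v c | c. c \<in> carrier_vec m} = carrier_vec d"
  obtains c where "\<forall>r<d. (\<Sum>i<m. U $$ (r, i) * c i) = (y r :: int)"
proof -
  have "vec d y \<in> {U *\<^sub>v c | c. c \<in> carrier_vec m}" using assms(2) by auto
  then obtain c where c: "c \<in> carrier_vec m" "U *\<^sub>v c = vec d y" by force
  have "(\<Sum>i<m. U $$ (r, i) * c $ i) = y r" if "r < d" for r
    using mult_mat_vec_index_sum[OF assms(1) c(1) that] c(2) that by simp
  then show ?thesis by (auto intro: that)
qed

text \<open>Integral preimages of the unit vectors, combined with the real coefficients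
  \<open>y k\<close>, form a preimage of \<open>y\<close>.\<close>

lemma int_surj_real_surj:
  fixes A :: "nat \<Rightarrow> nat \<Rightarrow> int" and y :: "nat \<Rightarrow> real"
  assumes "\<forall>y. \<exists>c. \<forall>r<d. (\<Sum>i<m. A r i * c i) = y r"
  shows "\<exists>c. \<forall>r<d. (\<Sum>i<m. real_of_int (A r i) * c i) = y r"
proof -
  have "\<exists>c. \<forall>r<d. (\<Sum>i<m. A r i * c i) = (if r = k then 1 else 0)" for k using assms by auto
  then obtain e where e: "\<And>k r. r < d \<Longrightarrow> (\<Sum>i<m. A r i * e k i) = (if r = k then 1 else 0)" by metis
  have "(\<Sum>i<m. real_of_int (A r i) * (\<Sum>k<d. y k * real_of_int (e k i))) = y r" if "r < d" for r
  proof -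
    have "(\<Sum>i<m. real_of_int (A r i) * (\<Sum>k<d. y k * real_of_int (e k i)))
      = (\<Sum>k<d. y k * real_of_int (\<Sum>i<m. A r i * e k i))"
      unfolding sum_distrib_left of_int_sum by (subst sum.swap) (simp add: algebra_simps)
    also have "\<dots> = (\<Sum>k<d. if r = k then y k else 0)"
      using e[OF that] by (intro sum.cong) auto
    also have "\<dots> = y r" using that by simp
    finally show ?thesis .
  qed
  then show ?thesis by (intro exI[of _ "\<lambda>i. \<Sum>k<d. y k * real_of_int (e k i)"]) auto
qed

section \<open>Unimodular completion\<close>

text \<open>The matrix is built along Euclid's algorithm on the entries of \<open>v\<close>.\<close>

lemma primitive_kernel_matrix:
  fixes v :: "nat \<Rightarrow> int"
  assumes "\<forall>i<m. v i \<ge> 0" "Gcd (v ` {..<m}) = 1"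
  shows "\<exists>A :: nat \<Rightarrow> nat \<Rightarrow> int.
    (\<forall>r<m-1. (\<Sum>i<m. A r i * v i) = 0) \<and>
    (\<forall>y. \<exists>c. \<forall>r<m-1. (\<Sum>i<m. A r i * c i) = y r) \<and>
    (\<forall>x. (\<forall>r<m-1. (\<Sum>i<m. real_of_int (A r i) * x i) = 0) \<longrightarrow> (\<exists>s. \<forall>i<m. x i = s * real_of_int (v i)))"
  using assms
proof (induction "nat (\<Sum>i<m. v i)" arbitrary: v rule: less_induct)
  case less
  show ?case
  proof (cases "\<exists>i<m. \<exists>j<m. i \<noteq> j \<and> v i \<ge> v j \<and> v j > 0")
    case True
    then obtain i j where ij: "i < m" "j < m" "i \<noteq> j" "v i \<ge> v j" "v j > 0" by blast
    \<comment> \<open>One subtraction step of Euclid's algorithm: gcd 1 and nonnegativity persist,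
      and the sum of the entries drops by \<open>v j > 0\<close>, which drives the
      induction.\<close>
    define v' where "v' = v(i := v i - v j)"
    have split: "(\<Sum>k<m. f k) = f i + (f j + (\<Sum>k\<in>{..<m}-{i}-{j}. f k))" for f :: "nat \<Rightarrow> 'b::comm_monoid_add"
      using ij by (simp add: sum.remove[of "{..<m}" i] sum.remove[of "{..<m}-{i}" j])
    have "(\<Sum>k<m. v' k) = (\<Sum>k<m. v k) - v j"
      using ij unfolding split[of v'] split[of v] by (simp add: v'_def)
    moreover have "(\<Sum>k<m. v k) \<ge> v j" using less.prems ij by (intro member_le_sum) auto
    ultimately have less': "nat (\<Sum>k<m. v' k) < nat (\<Sum>k<m. v k)" using ij by simp
    have pos': "\<forall>k<m. v' k \<ge> 0" using less.prems ij by (auto simp: v'_def)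
    have "Gcd (v' ` {..<m}) dvd v k" if "k < m" for k
    proof -
      have a: "Gcd (v' ` {..<m}) dvd v' k" if "k < m" for k using that by auto
      show ?thesis
      proof (cases "k = i")
        case True
        have "Gcd (v' ` {..<m}) dvd v' i + v' j" using a ij by (blast intro: dvd_add)
        then show ?thesis using True ij by (simp add: v'_def)
      next
        case False then show ?thesis using a[OF that] by (simp add: v'_def)
      qed
    qed
    then have "Gcd (v' ` {..<m}) dvd Gcd (v ` {..<m})" by (intro Gcd_greatest) auto
    then have gcd': "Gcd (v' ` {..<m}) = 1" using less.prems(2) by (simp add: zdvd1_eq)
    obtain A :: "nat \<Rightarrow> nat \<Rightarrow> int" where
      A1: "\<forall>r<m-1. (\<Sum>i<m. A r i * v' i) = 0" and
      A2: "\<forall>y. \<exists>c. \<forall>r<m-1. (\<Sum>i<m. A r i * c i) = y r" and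
      A3: "\<forall>x. (\<forall>r<m-1. (\<Sum>i<m. real_of_int (A r i) * x i) = 0) \<longrightarrow> (\<exists>s. \<forall>i<m. x i = s * real_of_int (v' i))"
      using less.hyps[OF less' pos' gcd'] by blast
    \<comment> \<open>The column operation adjoint to that step: applying \<open>B\<close> to
      \<open>c\<close> is applying \<open>A\<close> after replacing \<open>c i\<close> by
      \<open>c i - c j\<close>. This substitution sends \<open>v\<close> to \<open>v'\<close> and is
      invertible over the integers, so all three properties carry over.\<close>
    define B where "B = (\<lambda>r. (A r)(j := A r j - A r i))"
    have B: "(\<Sum>k<m. B r k * c k) = (\<Sum>k<m. A r k * (c(i := c i - c j)) k)" for r and c :: "nat \<Rightarrow> int"
      using ij unfolding split[of "\<lambda>k. B r k * c k"] split[of "\<lambda>k. A r k * (c(i := c i - c j)) k"]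
      by (simp add: B_def algebra_simps)
    have BR: "(\<Sum>k<m. real_of_int (B r k) * c k) = (\<Sum>k<m. real_of_int (A r k) * (c(i := c i - c j)) k)"
      for r and c :: "nat \<Rightarrow> real"
      using ij unfolding split[of "\<lambda>k. real_of_int (B r k) * c k"] split[of "\<lambda>k. real_of_int (A r k) * (c(i := c i - c j)) k"]
      by (simp add: B_def algebra_simps)
    have "\<exists>c. \<forall>r<m-1. (\<Sum>i<m. B r i * c i) = y r" for y
    proof -
      obtain c where c: "\<forall>r<m-1. (\<Sum>i<m. A r i * c i) = y r" using A2 by blast
      have "(c(i := c i + c j))(i := (c(i := c i + c j)) i - (c(i := c i + c j)) j) = c" using ij by auto
      then show ?thesis using c by (intro exI[of _ "c(i := c i + c j)"]) (simp only: B)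
    qed
    moreover have "\<exists>s. \<forall>k<m. x k = s * real_of_int (v k)"
      if H: "\<forall>r<m-1. (\<Sum>i<m. real_of_int (B r i) * x i) = 0" for x
    proof -
      obtain s where s: "\<forall>k<m. (x(i := x i - x j)) k = s * real_of_int (v' k)"
        using A3 H unfolding BR by blast
      have "x k = s * real_of_int (v k)" if "k < m" for k
        using s[rule_format, OF that] s[rule_format, OF ij(2)] ij
        by (auto simp: v'_def algebra_simps split: if_splits)
      then show ?thesis by blast
    qed
    moreover have "\<forall>r<m-1. (\<Sum>i<m. B r i * v i) = 0"
      using A1 unfolding B v'_def by blast
    ultimately show ?thesis by blast
  next
    case False
    \<comment> \<open>No two entries are positive now, since the larger would allow another
      subtraction. The gcd then leaves exactly one nonzero entry, equal to 1, and \<open>A\<close>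
      can be the matrix that deletes its coordinate.\<close>
    have "\<exists>i0<m. v i0 \<noteq> 0"
    proof (rule ccontr)
      assume "\<not> ?thesis"
      then have "Gcd (v ` {..<m}) = 0" by auto
      then show False using less.prems(2) by simp
    qed
    then obtain i0 where i0: "i0 < m" "v i0 \<noteq> 0" by blast
    have z: "v k = 0" if "k < m" "k \<noteq> i0" for k
      using False i0 that less.prems(1) by (metis le_less linorder_linear)
    have "v i0 dvd Gcd (v ` {..<m})"
    proof (rule Gcd_greatest)
      fix b assume "b \<in> v ` {..<m}"
      then obtain k where "k < m" "b = v k" by auto
      then show "v i0 dvd b" using z by (cases "k = i0") auto
    qed
    then have one: "v i0 = 1" using less.prems i0 by (auto simp: zdvd1_eq)
    define sk where "sk = (\<lambda>r. if r < i0 then r else Suc r)"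
    define A :: "nat \<Rightarrow> nat \<Rightarrow> int" where "A = (\<lambda>r i. if i = sk r then 1 else 0)"
    have sk: "sk r < m" "sk r \<noteq> i0" if "r < m - 1" for r using that i0 by (auto simp: sk_def)
    have S: "(\<Sum>i<m. A r i * c i) = c (sk r)" if "r < m - 1" for r c
      using sk[OF that] by (simp add: A_def if_distrib[of "\<lambda>x. x * _"] cong: if_cong)
    have SR: "(\<Sum>i<m. real_of_int (A r i) * c i) = c (sk r)" if "r < m - 1" for r c
      using sk[OF that] by (simp add: A_def if_distrib[of "\<lambda>x. real_of_int x * _"] cong: if_cong)
    have "\<exists>c. \<forall>r<m-1. (\<Sum>i<m. A r i * c i) = y r" for y
      by (rule exI[of _ "\<lambda>i. if i < i0 then y i else y (i - 1)"]) (auto simp: S sk_def)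
    moreover have "\<exists>s. \<forall>k<m. x k = s * real_of_int (v k)"
      if H: "\<forall>r<m-1. (\<Sum>i<m. real_of_int (A r i) * x i) = 0" for x
    proof (rule exI[of _ "x i0"], intro allI impI)
      fix k assume k: "k < m"
      show "x k = x i0 * real_of_int (v k)"
      proof (cases "k = i0")
        case True then show ?thesis using one by simp
      next
        case False
        have "sk (if k < i0 then k else k - 1) = k" "(if k < i0 then k else k - 1) < m - 1"
          using False k i0 by (auto simp: sk_def)
        then have "x k = 0" using H SR by metis
        then show ?thesis using z[OF k False] by simp
      qed
    qed
    moreover have "\<forall>r<m-1. (\<Sum>i<m. A r i * v i) = 0" using S sk z by simp
    ultimately show ?thesis by blast
  qed
qed

section \<open>Runners\<close>

text \<open>Pulling \<open>\<rho> Z\<^sub>v + \<int>\<^bsup>m-1\<^esup> = \<real>\<^bsup>m-1\<^esup>\<close> back along \<open>U\<close>, whose kernel is spanned by \<open>v\<close>, gives this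
  condition: for all starting points \<open>x\<close> on the circle \<open>\<real>/\<int>\<close>, the runners are in the arc \<open>[0, \<rho>]\<close> at
  a common time \<open>s\<close>.\<close>

definition runners_meet :: "'a set \<Rightarrow> ('a \<Rightarrow> int) \<Rightarrow> real \<Rightarrow> bool" where
  "runners_meet I v \<rho> \<longleftrightarrow>
     (\<forall>x. \<exists>s. \<forall>i\<in>I. \<exists>c. x i + s * real_of_int (v i) - real_of_int c \<in> {0..\<rho>})"

text \<open>For each \<open>x\<close>, the point \<open>A x\<close> lies in a lattice translate of
  the scaled zonotope. Lifting this back along \<open>A\<close> leaves an error in the kernel, a
  multiple \<open>s v\<close>, and \<open>s\<close> is the meeting time. The
  \<open>\<epsilon>\<close> is there because the covering radius is an infimum, from which only
  nearby covering values are extracted.\<close>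

lemma conjecture_C_runners_primitive:
  fixes v :: "nat \<Rightarrow> int"
  assumes C: "conjecture_C m" and pos: "\<forall>i<m. v i > 0" and gcd: "Gcd (v ` {..<m}) = 1"
    and inj: "inj_on v {..<m}" and "\<epsilon> > 0"
  shows "\<exists>\<rho>>0. \<rho> < (real m - 1) / (real m + 1) + \<epsilon> \<and> runners_meet {..<m} v \<rho>"
proof -
  obtain A :: "nat \<Rightarrow> nat \<Rightarrow> int" where
      A1: "\<forall>r<m-1. (\<Sum>i<m. A r i * v i) = 0" and
      A2: "\<forall>y. \<exists>c. \<forall>r<m-1. (\<Sum>i<m. A r i * c i) = y r" and
      A3: "\<forall>x. (\<forall>r<m-1. (\<Sum>i<m. real_of_int (A r i) * x i) = 0) \<longrightarrow> (\<exists>s. \<forall>i<m. x i = s * real_of_int (v i))"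
    using primitive_kernel_matrix[of m v] pos gcd by force
  define U where "U = mat (m - 1) m (\<lambda>(r, i). A r i)"
  have U: "U \<in> carrier_mat (m - 1) m" by (simp add: U_def)
  have idx: "(U *\<^sub>v c) $ r = (\<Sum>i<m. A r i * c $ i)" if "c \<in> carrier_vec m" "r < m - 1" for c r
    using mult_mat_vec_index_sum[OF U that] that by (simp add: U_def)
  have surj: "{U *\<^sub>v c | c. c \<in> carrier_vec m} = carrier_vec (m - 1)"
  proof (intro equalityI subsetI)
    fix y :: "int vec" assume y: "y \<in> carrier_vec (m - 1)"
    obtain c where c: "\<forall>r<m-1. (\<Sum>i<m. A r i * c i) = y $ r" using A2 by blast
    have "y = U *\<^sub>v vec m c" using y U c idx[of "vec m c"] by (intro eq_vecI) auto
    then show "y \<in> {U *\<^sub>v c | c. c \<in> carrier_vec m}" by auto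
  qed (use U in auto)
  have ker: "U *\<^sub>v vec m v = 0\<^sub>v (m - 1)" using U A1 idx[of "vec m v"] by (intro eq_vecI) auto
  have "{vec m v $ i |i. i < m} = v ` {..<m}" by force
  then have "LR_generators m (vec m v) U"
    using U surj ker pos gcd by (simp add: LR_generators_def)
  moreover have "inj_on (\<lambda>i. vec m v $ i) {..<m}" using inj by (auto simp: inj_on_def)
  ultimately have "strong_LR_zonotope m (zonotope U)" by (auto simp: strong_LR_zonotope_def)
  then have le: "covering_radius (m - 1) (zonotope U) \<le> (real m - 1) / (real m + 1)"
    using C by (auto simp: conjecture_C_def)
  let ?S = "{\<rho>. \<rho> > 0 \<and> {\<rho> \<cdot>\<^sub>v x + z | x z. x \<in> zonotope U \<and> z \<in> int_points (m - 1)} = carrier_vec (m - 1)}"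
  note lift = int_surj_real_surj[OF A2]
  \<comment> \<open>An infimum can be approached only if the set is nonempty. At scale 1, the
    fractional parts of a real preimage of \<open>y\<close> give the zonotope point and its floors
    the lattice point.\<close>
  have "1 \<in> ?S"
  proof -
    have "\<exists>t z. (\<forall>i<m. 0 \<le> t i \<and> t i \<le> 1) \<and>
       (\<forall>r<m-1. y r = 1 * (\<Sum>i<m. real_of_int (U $$ (r, i)) * t i) + real_of_int (z r))" for y
    proof -
      obtain c where c: "\<forall>r<m-1. (\<Sum>i<m. real_of_int (A r i) * c i) = y r" using lift by blast
      show ?thesis
      proof (intro exI[of _ "\<lambda>i. frac (c i)"] exI[of _ "\<lambda>r. \<Sum>i<m. A r i * \<lfloor>c i\<rfloor>"] conjI allI impI)
        fix r assume r: "r < m - 1"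
        have "y r = (\<Sum>i<m. real_of_int (A r i) * frac (c i) + real_of_int (A r i) * real_of_int \<lfloor>c i\<rfloor>)"
          using c r by (simp add: frac_def algebra_simps)
        then show "y r = 1 * (\<Sum>i<m. real_of_int (U $$ (r, i)) * frac (c i)) + real_of_int (\<Sum>i<m. A r i * \<lfloor>c i\<rfloor>)"
          using r by (simp add: U_def sum.distrib)
      qed (auto simp: frac_ge_0 frac_lt_1 less_imp_le)
    qed
    then show ?thesis using translates_cover_iff[OF U, of 1] by simp
  qed
  moreover have "Inf ?S < (real m - 1) / (real m + 1) + \<epsilon>"
    using le \<open>\<epsilon> > 0\<close> unfolding covering_radius_def by linarith
  ultimately have "\<exists>\<rho>\<in>?S. \<rho> < (real m - 1) / (real m + 1) + \<epsilon>"
    by (intro cInf_lessD) (simp only: ex_in_conv[symmetric], rule exI)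
  then obtain \<rho> where "\<rho> \<in> ?S" and \<rho>l: "\<rho> < (real m - 1) / (real m + 1) + \<epsilon>"
    by blast
  then have \<rho>0: "\<rho> > 0" and cov: "\<forall>y. \<exists>t z. (\<forall>i<m. 0 \<le> t i \<and> t i \<le> 1) \<and>
       (\<forall>r<m-1. y r = \<rho> * (\<Sum>i<m. real_of_int (U $$ (r, i)) * t i) + real_of_int (z r))"
    using translates_cover_iff[OF U, of \<rho>] by auto
  have "runners_meet {..<m} v \<rho>"
    unfolding runners_meet_def
  proof
    fix x :: "nat \<Rightarrow> real"
    obtain t z where t: "\<forall>i<m. 0 \<le> t i \<and> t i \<le> 1"
      and e: "\<forall>r<m-1. (\<Sum>i<m. real_of_int (A r i) * x i) = \<rho> * (\<Sum>i<m. real_of_int (U $$ (r, i)) * t i) + real_of_int (z r)"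
      using spec[OF cov, of "\<lambda>r. \<Sum>i<m. real_of_int (A r i) * x i"] by blast
    obtain c where c: "\<forall>r<m-1. (\<Sum>i<m. A r i * c i) = z r" using A2 by blast
    have "(\<Sum>i<m. real_of_int (A r i) * (\<rho> * t i + real_of_int (c i) - x i)) = 0" if "r < m - 1" for r
    proof -
      have "(\<Sum>i<m. real_of_int (A r i) * (\<rho> * t i + real_of_int (c i) - x i))
        = \<rho> * (\<Sum>i<m. real_of_int (A r i) * t i) + real_of_int (\<Sum>i<m. A r i * c i) - (\<Sum>i<m. real_of_int (A r i) * x i)"
        by (simp add: sum.distrib sum_subtractf sum_distrib_left algebra_simps)
      then show ?thesis using e c that by (simp add: U_def del: of_int_sum)
    qed
    then obtain s where s: "\<forall>i<m. \<rho> * t i + real_of_int (c i) - x i = s * real_of_int (v i)"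
      using A3 by (elim allE[of _ "\<lambda>i. \<rho> * t i + real_of_int (c i) - x i"]) auto
    have "x i + s * real_of_int (v i) - real_of_int (c i) = \<rho> * t i" if "i < m" for i
      using s that by (simp add: algebra_simps)
    then show "\<exists>s. \<forall>i\<in>{..<m}. \<exists>c. x i + s * real_of_int (v i) - real_of_int c \<in> {0..\<rho>}"
      using t \<rho>0 by (metis atLeastAtMost_iff lessThan_iff mult_left_le mult_nonneg_nonneg less_imp_le)
  qed
  then show ?thesis using \<rho>0 \<rho>l by blast
qed

text \<open>Dividing the velocities by their gcd only rescales time, and a change of sign only
  reflects the arc, so the primitive positive case suffices. As signs are removed, it is the
  absolute values that must be distinct.\<close>

lemma conjecture_C_runners:
  fixes v :: "'a \<Rightarrow> int"
  assumes C: "conjecture_C (card I)" and I: "finite I" "I \<noteq> {}" and nz: "\<forall>i\<in>I. v i \<noteq> 0"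
    and inj: "inj_on (\<lambda>i. \<bar>v i\<bar>) I" and "\<epsilon> > 0"
  shows "\<exists>\<rho>>0. \<rho> < (real (card I) - 1) / (real (card I) + 1) + \<epsilon> \<and> runners_meet I v \<rho>"
proof -
  obtain h where h: "bij_betw h {..<card I} I"
    using ex_bij_betw_nat_finite[OF I(1)] by (auto simp: lessThan_atLeast0)
  have hI: "h ` {..<card I} = I" using h by (simp add: bij_betw_def)
  define g where "g = Gcd ((\<lambda>i. \<bar>v i\<bar>) ` I)"
  have g0: "g > 0"
  proof -
    have "g \<noteq> 0" using I nz by (auto simp: g_def)
    moreover have "g \<ge> 0" by (simp add: g_def)
    ultimately show ?thesis by simp
  qed
  have gd: "\<bar>v i\<bar> = g * (\<bar>v i\<bar> div g)" if "i \<in> I" for i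
  proof -
    have "g dvd \<bar>v i\<bar>" unfolding g_def using that by (intro Gcd_dvd) auto
    then show ?thesis by simp
  qed
  define w where "w = (\<lambda>k. \<bar>v (h k)\<bar> div g)"
  have w: "\<bar>v (h k)\<bar> = g * w k" if "k < card I" for k using gd hI that by (auto simp: w_def)
  have "(\<lambda>i. \<bar>v i\<bar>) ` I = (\<lambda>k. \<bar>v (h k)\<bar>) ` {..<card I}"
    by (metis hI image_image)
  also have "\<dots> = (*) g ` (w ` {..<card I})"
    unfolding image_image by (rule image_cong) (use w in auto)
  finally have "(*) g ` (w ` {..<card I}) = (\<lambda>i. \<bar>v i\<bar>) ` I" ..
  then have "g = normalize (g * Gcd (w ` {..<card I}))"
    unfolding g_def by (metis Gcd_mult)
  then have "g * 1 = g * Gcd (w ` {..<card I})" using g0 by (simp add: abs_mult)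
  then have "Gcd (w ` {..<card I}) = 1" using g0 by (metis mult_left_cancel less_irrefl)
  moreover have "\<forall>k<card I. w k > 0"
    using w nz hI g0 by (metis abs_ge_zero abs_eq_0 imageI lessThan_iff le_less mult_eq_0_iff zero_less_mult_pos)
  moreover have "inj_on w {..<card I}"
  proof (rule inj_onI)
    fix a b assume "a \<in> {..<card I}" "b \<in> {..<card I}" "w a = w b"
    then have "\<bar>v (h a)\<bar> = \<bar>v (h b)\<bar>" "h a \<in> I" "h b \<in> I" using w hI by auto
    then have "h a = h b" using inj by (auto dest: inj_onD)
    then show "a = b" using h \<open>a \<in> _\<close> \<open>b \<in> _\<close> by (auto simp: bij_betw_def dest: inj_onD)
  qed
  ultimately obtain \<rho> where \<rho>: "\<rho> > 0" "\<rho> < (real (card I) - 1) / (real (card I) + 1) + \<epsilon>"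
    and m: "runners_meet {..<card I} w \<rho>"
    using conjecture_C_runners_primitive[OF C, of w \<epsilon>] \<open>\<epsilon> > 0\<close> by blast
  have "runners_meet I v \<rho>"
    unfolding runners_meet_def
  proof
    fix x :: "'a \<Rightarrow> real"
    \<comment> \<open>A runner with negative velocity is reflected in the arc \<open>[0, \<rho>]\<close>.\<close>
    obtain s where s: "\<forall>k\<in>{..<card I}. \<exists>c. (if v (h k) > 0 then x (h k) else \<rho> - x (h k)) + s * real_of_int (w k) - real_of_int c \<in> {0..\<rho>}"
      using m unfolding runners_meet_def
      by (elim allE[of _ "\<lambda>k. if v (h k) > 0 then x (h k) else \<rho> - x (h k)"]) blast
    have "\<exists>c. x i + s / g * real_of_int (v i) - real_of_int c \<in> {0..\<rho>}" if "i \<in> I" for i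
    proof -
      obtain k where k: "k < card I" "i = h k" using hI \<open>i \<in> I\<close> by auto
      obtain c where c: "(if v i > 0 then x i else \<rho> - x i) + s * real_of_int (w k) - real_of_int c \<in> {0..\<rho>}"
        using s k by auto
      have "real_of_int \<bar>v i\<bar> = real_of_int g * real_of_int (w k)" using w k by (metis of_int_mult)
      then have e: "s / g * real_of_int \<bar>v i\<bar> = s * real_of_int (w k)" using g0 by simp
      show ?thesis
      proof (cases "v i > 0")
        case True then show ?thesis using c e by (intro exI[of _ c]) auto
      next
        case False then show ?thesis using c e by (intro exI[of _ "- c"]) auto
      qed
    qed
    then show "\<exists>s. \<forall>i\<in>I. \<exists>c. x i + s * real_of_int (v i) - real_of_int c \<in> {0..\<rho>}" by blast
  qed
  then show ?thesis using \<rho> by blast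
qed

section \<open>Lonely vectors\<close>

text \<open>Turns parallelism into the vanishing of a determinant, which is linear in each vector.
  On both sides the zero vector is parallel to everything.\<close>

lemma parallel_iff_cross: "parallel x y \<longleftrightarrow> fst x * snd y = fst y * snd x"
proof
  assume "parallel x y" then show "fst x * snd y = fst y * snd x" by (auto simp: parallel_def)
next
  assume e: "fst x * snd y = fst y * snd x"
  show "parallel x y"
  proof (cases "fst x = 0")
    case False
    then have "y = (fst y / fst x) *\<^sub>R x" using e by (auto simp: prod_eq_iff field_simps)
    then show ?thesis unfolding parallel_def by blast
  next
    case True
    show ?thesis
    proof (cases "snd x = 0")
      case False
      then have "y = (snd y / snd x) *\<^sub>R x" using e True by (auto simp: prod_eq_iff)
      then show ?thesis unfolding parallel_def by blast
    next
    next
      case s: True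
      then have "x = 0 *\<^sub>R y" using True by (simp add: prod_eq_iff)
      then show ?thesis unfolding parallel_def by blast
    qed
  qed
qed

text \<open>Even if \<open>f a = f b\<close>, deleting the copy contributed by \<open>a\<close>
  leaves the one contributed by \<open>b\<close>. This locates vectors in the multiset beside the
  lonely one.\<close>

lemma image_mset_remove_other:
  assumes "finite T" "a \<in> T" "b \<in> T" "a \<noteq> b"
  shows "f b \<in># image_mset f (mset_set T) - {#f a#}"
proof -
  have "mset_set T = add_mset a (mset_set (T - {a}))" using assms by (simp add: mset_set.remove)
  then show ?thesis using assms by simp
qed

text \<open>With \<open>P i = (v i, w i)\<close> and a lonely vector \<open>x\<close>, the
  coefficients are the determinants of \<open>x\<close> with the \<open>P l\<close>. One vanishes
  exactly if \<open>P l\<close> is parallel to \<open>x\<close>, and two agree up to sign exactly if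
  \<open>P l + P m\<close> or \<open>P l - P m\<close> is; loneliness excludes both away from
  \<open>j\<close>. The last clause records whether \<open>x\<close> is \<open>P j\<close> itself or
  combines \<open>P j\<close> with some \<open>P i\<close>.\<close>

lemma lonely_relation:
  fixes v w :: "nat \<Rightarrow> int"
  assumes LVP: "LVP n" and pos: "\<forall>i<n. v i > 0" and inj: "inj_on v {..<n}"
    and np: "i0 < n" "j0 < n" "v i0 * w j0 \<noteq> v j0 * w i0"
  shows "\<exists>a b j. j < n \<and> (\<forall>l\<in>{..<n}-{j}. a * v l + b * w l \<noteq> 0) \<and>
    inj_on (\<lambda>l. \<bar>a * v l + b * w l\<bar>) ({..<n}-{j}) \<and>
    (a * v j + b * w j = 0 \<or> (\<exists>i\<in>{..<n}-{j}. \<bar>a * v i + b * w i\<bar> = \<bar>a * v j + b * w j\<bar>))"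
proof -
  define P where "P = (\<lambda>i. (real_of_int (v i), real_of_int (w i)))"
  define p where "p = map P [0..<n]"
  have p: "length p = n" "\<And>i. i < n \<Longrightarrow> p ! i = P i" by (auto simp: p_def)
  have "set p \<subseteq> \<rat> \<times> \<rat>" by (auto simp: p_def P_def)
  moreover have "LV_admissible p"
    unfolding LV_admissible_def
  proof (intro conjI allI impI)
    fix i assume "i < length p" then show "p ! i \<noteq> 0"
      using pos p by (force simp: P_def prod_eq_iff)
  next
    have "\<not> parallel (P i0) (P j0)"
      using np(3) unfolding parallel_iff_cross P_def fst_conv snd_conv of_int_mult[symmetric] of_int_eq_iff .
    then show "\<not> (\<forall>i<length p. \<forall>j<length p. parallel (p ! i) (p ! j))"
      using np p by metis
  next
    fix i j assume ij: "i < j \<and> j < length p"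
    \<comment> \<open>Distinct first coordinates rule out equal vectors, positive ones rule out
      opposite vectors.\<close>
    then have "v i \<noteq> v j" using inj p by (auto dest: inj_onD)
    moreover have "v i > 0" "v j > 0" using ij pos p by auto
    ultimately show "p ! i \<noteq> p ! j" "p ! i \<noteq> - (p ! j)" using ij p by (auto simp: P_def)
  qed
  ultimately have "LV_property p" using LVP p by (auto simp: LVP_def)
  define T where "T = {(i, j). i < j \<and> j < n}"
  have finT: "finite T" by (rule finite_subset[of _ "{..<n} \<times> {..<n}"]) (auto simp: T_def)
  define MA where "MA = image_mset P (mset_set {..<n})"
  define MB where "MB = image_mset (\<lambda>(i, j). P i + P j) (mset_set T)"
  define MC where "MC = image_mset (\<lambda>(i, j). P i - P j) (mset_set T)"
  have "LV_multiset p = MA + MB + MC"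
  proof -
    have "mset p = MA" by (simp add: p_def MA_def lessThan_atLeast0)
    moreover have "{# p ! i + p ! j. (i, j) \<in># mset_set T #} = MB"
      unfolding MB_def by (rule image_mset_cong) (use finT p in \<open>auto simp: T_def\<close>)
    moreover have "{# p ! i - p ! j. (i, j) \<in># mset_set T #} = MC"
      unfolding MC_def by (rule image_mset_cong) (use finT p in \<open>auto simp: T_def\<close>)
    ultimately show ?thesis by (simp add: LV_multiset_def p(1) T_def)
  qed
  then obtain x where xM: "x \<in># MA + MB + MC"
    and lonely: "\<And>y. y \<in># MA + MB + MC - {#x#} \<Longrightarrow> fst x * snd y \<noteq> fst y * snd x"
    using \<open>LV_property p\<close> unfolding LV_property_def parallel_iff_cross by metis
  have inA: "P l \<in># MA" if "l < n" for l using that by (auto simp: MA_def)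
  have inB: "P l + P m \<in># MB" if "l < m" "m < n" for l m
    using that finT unfolding MB_def by (auto simp: T_def intro!: image_eqI[of _ _ "(l, m)"])
  have inC: "P l - P m \<in># MC" if "l < m" "m < n" for l m
    using that finT unfolding MC_def by (auto simp: T_def intro!: image_eqI[of _ _ "(l, m)"])
  \<comment> \<open>The common end of the three cases. The index \<open>j\<close> takes part in
    forming \<open>x\<close>, so the vectors built from other indices survive the deletion of one
    copy of \<open>x\<close>. The choice \<open>a = - B\<close>, \<open>b = A\<close> makes
    \<open>a * v l + b * w l\<close> the determinant of \<open>x\<close> and
    \<open>P l\<close>.\<close>
  have goal: ?thesis
    if x: "x = (real_of_int A, real_of_int B)" and j: "j < n"
      and hA: "\<And>l. l < n \<Longrightarrow> l \<noteq> j \<Longrightarrow> P l \<in># MA + MB + MC - {#x#}"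
      and hB: "\<And>l m. l < m \<Longrightarrow> m < n \<Longrightarrow> l \<noteq> j \<Longrightarrow> m \<noteq> j \<Longrightarrow> P l + P m \<in># MA + MB + MC - {#x#}"
      and hC: "\<And>l m. l < m \<Longrightarrow> m < n \<Longrightarrow> l \<noteq> j \<Longrightarrow> m \<noteq> j \<Longrightarrow> P l - P m \<in># MA + MB + MC - {#x#}"
      and rel: "A * w j = B * v j \<or> (\<exists>i\<in>{..<n}-{j}. \<bar>- B * v i + A * w i\<bar> = \<bar>- B * v j + A * w j\<bar>)"
    for A B j
  proof -
    have nz: "- B * v l + A * w l \<noteq> 0" if l: "l < n" "l \<noteq> j" for l
    proof
      assume "- B * v l + A * w l = 0"
      then have "A * w l = v l * B" by (simp add: algebra_simps)
      then have "fst x * snd (P l) = fst (P l) * snd x"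
        unfolding x P_def fst_conv snd_conv of_int_mult[symmetric] by simp
      then show False using lonely[OF hA[OF l]] by blast
    qed
    have ne: "\<bar>- B * v l + A * w l\<bar> \<noteq> \<bar>- B * v m + A * w m\<bar>"
      if lm: "l < m" "m < n" "l \<noteq> j" "m \<noteq> j" for l m
    proof
      assume "\<bar>- B * v l + A * w l\<bar> = \<bar>- B * v m + A * w m\<bar>"
      \<comment> \<open>Opposite determinants make the sum parallel to \<open>x\<close>, equal ones
        the difference.\<close>
      then consider "A * (w l + w m) = (v l + v m) * B" | "A * (w l - w m) = (v l - v m) * B"
        by (auto simp: abs_eq_iff algebra_simps)
      then show False
      proof cases
        case 1
        then have "fst x * snd (P l + P m) = fst (P l + P m) * snd x"
          unfolding x P_def fst_conv snd_conv fst_add snd_add of_int_mult[symmetric] of_int_add[symmetric] by simp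
        then show False using lonely[OF hB[OF lm]] by blast
      next
        case 2
        then have "fst x * snd (P l - P m) = fst (P l - P m) * snd x"
          unfolding x P_def fst_conv snd_conv fst_diff snd_diff of_int_mult[symmetric] of_int_diff[symmetric] by simp
        then show False using lonely[OF hC[OF lm]] by blast
      qed
    qed
    have "inj_on (\<lambda>l. \<bar>- B * v l + A * w l\<bar>) ({..<n}-{j})"
      by (rule linorder_inj_onI) (use ne in auto)
    then show ?thesis using j nz rel
      by (intro exI[of _ "- B"] exI[of _ A] exI[of _ j]) auto
  qed
  from xM consider "x \<in># MA" | "x \<in># MB" | "x \<in># MC" by auto
  then show ?thesis
  proof cases
    case 1
    then obtain j where j: "j < n" "x = P j" by (auto simp: MA_def)
    show ?thesis
    proof (rule goal[of "v j" "w j" j])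
      fix l assume "l < n" "l \<noteq> j"
      then have "P l \<in># MA - {#P j#}"
        unfolding MA_def using j by (intro image_mset_remove_other) auto
      then show "P l \<in># MA + MB + MC - {#x#}" using j(2) by (auto simp: in_diff_count split: if_splits)
    next
      fix l m :: nat assume "l < m" "m < n"
      then show "P l + P m \<in># MA + MB + MC - {#x#}" "P l - P m \<in># MA + MB + MC - {#x#}"
        using inB[of l m] inC[of l m] 1 by (auto simp: in_diff_count simp flip: count_greater_zero_iff)
    qed (use j in \<open>auto simp: P_def\<close>)
  next
    case 2
    then obtain i j where ij: "i < j" "j < n" "x = P i + P j" using finT by (auto simp: MB_def T_def)
    show ?thesis
    proof (rule goal[of "v i + v j" "w i + w j" j])
      fix l assume "l < n" "l \<noteq> j"
      then show "P l \<in># MA + MB + MC - {#x#}"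
        using inA[of l] 2 by (auto simp: in_diff_count simp flip: count_greater_zero_iff)
    next
      fix l m :: nat assume lm: "l < m" "m < n" "l \<noteq> j" "m \<noteq> j"
      then show "P l - P m \<in># MA + MB + MC - {#x#}"
        using inC[of l m] 2 by (auto simp: in_diff_count simp flip: count_greater_zero_iff)
      \<comment> \<open>The pair \<open>(l, m)\<close> avoids \<open>j\<close>, hence differs from
        the pair \<open>(i, j)\<close> that accounts for the deleted copy.\<close>
      have "(\<lambda>(i, j). P i + P j) (l, m) \<in># MB - {#(\<lambda>(i, j). P i + P j) (i, j)#}"
        unfolding MB_def by (rule image_mset_remove_other) (use finT lm ij in \<open>auto simp: T_def\<close>)
      then show "P l + P m \<in># MA + MB + MC - {#x#}"
        using ij(3) by (auto simp: in_diff_count split: if_splits)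
    next
      \<comment> \<open>The determinant of \<open>x = P i + P j\<close> with itself vanishes, so its
        determinants with \<open>P i\<close> and \<open>P j\<close> are opposite.\<close>
      have "- (w i + w j) * v i + (v i + v j) * w i = - (- (w i + w j) * v j + (v i + v j) * w j)"
        by (simp add: algebra_simps)
      then have "\<bar>- (w i + w j) * v i + (v i + v j) * w i\<bar> = \<bar>- (w i + w j) * v j + (v i + v j) * w j\<bar>"
        by (simp only: abs_minus_cancel)
      then show "(v i + v j) * w j = (w i + w j) * v j \<or> (\<exists>k\<in>{..<n}-{j}.
        \<bar>- (w i + w j) * v k + (v i + v j) * w k\<bar> = \<bar>- (w i + w j) * v j + (v i + v j) * w j\<bar>)"
        using ij by (intro disjI2 bexI[of _ i]) auto
    qed (use ij in \<open>auto simp: P_def\<close>)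
  next
    case 3
    then obtain i j where ij: "i < j" "j < n" "x = P i - P j" using finT by (auto simp: MC_def T_def)
    show ?thesis
    proof (rule goal[of "v i - v j" "w i - w j" j])
      fix l assume "l < n" "l \<noteq> j"
      then show "P l \<in># MA + MB + MC - {#x#}"
        using inA[of l] 3 by (auto simp: in_diff_count simp flip: count_greater_zero_iff)
    next
      fix l m :: nat assume lm: "l < m" "m < n" "l \<noteq> j" "m \<noteq> j"
      then show "P l + P m \<in># MA + MB + MC - {#x#}"
        using inB[of l m] 3 by (auto simp: in_diff_count simp flip: count_greater_zero_iff)
      have "(\<lambda>(i, j). P i - P j) (l, m) \<in># MC - {#(\<lambda>(i, j). P i - P j) (i, j)#}"
        unfolding MC_def by (rule image_mset_remove_other) (use finT lm ij in \<open>auto simp: T_def\<close>)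
      then show "P l - P m \<in># MA + MB + MC - {#x#}"
        using ij(3) by (auto simp: in_diff_count split: if_splits)
    next
      \<comment> \<open>For \<open>x = P i - P j\<close> the same argument makes the two
        determinants equal.\<close>
      have "- (w i - w j) * v i + (v i - v j) * w i = - (w i - w j) * v j + (v i - v j) * w j"
        by (simp add: algebra_simps)
      then have "\<bar>- (w i - w j) * v i + (v i - v j) * w i\<bar> = \<bar>- (w i - w j) * v j + (v i - v j) * w j\<bar>"
        by (simp only:)
      then show "(v i - v j) * w j = (w i - w j) * v j \<or> (\<exists>k\<in>{..<n}-{j}.
        \<bar>- (w i - w j) * v k + (v i - v j) * w k\<bar> = \<bar>- (w i - w j) * v j + (v i - v j) * w j\<bar>)"
        using ij by (intro disjI2 bexI[of _ i]) auto
    qed (use ij in \<open>auto simp: P_def\<close>)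
  qed
qed

section \<open>Lattice segments\<close>

text \<open>Two times are available. First \<open>\<alpha>\<close> ties runner \<open>j\<close> to
  one of the others, or parks it if \<open>u j = 0\<close>; then \<open>meet\<close>, applied to the
  starting points shifted by \<open>\<alpha> v\<close>, brings \<open>j\<close> along. Positive
  distinct velocities \<open>v\<close> keep the denominators in \<open>\<alpha>\<close>
  nonzero.\<close>

lemma runners_meet_extend:
  fixes u v :: "'a \<Rightarrow> int" and x :: "'a \<Rightarrow> real"
  assumes meet: "runners_meet (I - {j}) u \<rho>" and \<rho>: "\<rho> \<ge> 0" and j: "j \<in> I"
    and pos: "\<forall>i\<in>I. v i > 0" and inj: "inj_on v I"
    and rel: "u j = 0 \<or> (\<exists>i\<in>I - {j}. \<bar>u i\<bar> = \<bar>u j\<bar>)"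
  shows "\<exists>\<alpha> s. \<forall>i\<in>I. \<exists>c. x i + \<alpha> * real_of_int (v i) + s * real_of_int (u i) - real_of_int c \<in> {0..\<rho>}"
proof -
  have ex: "\<exists>\<alpha> s. \<forall>i\<in>I. \<exists>c. x i + \<alpha> * real_of_int (v i) + s * real_of_int (u i) - real_of_int c \<in> {0..\<rho>}"
    if H: "\<And>s. (\<forall>i\<in>I - {j}. \<exists>c. x i + \<alpha> * real_of_int (v i) + s * real_of_int (u i) - real_of_int c \<in> {0..\<rho>})
      \<Longrightarrow> \<exists>c. x j + \<alpha> * real_of_int (v j) + s * real_of_int (u j) - real_of_int c \<in> {0..\<rho>}" for \<alpha>
  proof -
    obtain s where "\<forall>i\<in>I - {j}. \<exists>c. x i + \<alpha> * real_of_int (v i) + s * real_of_int (u i) - real_of_int c \<in> {0..\<rho>}"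
      using meet unfolding runners_meet_def by (elim allE[of _ "\<lambda>i. x i + \<alpha> * real_of_int (v i)"]) blast
    then show ?thesis using H by blast
  qed
  \<comment> \<open>Time \<open>\<alpha>\<close> along \<open>v\<close> is chosen so that runner \<open>j\<close> sits at \<open>0\<close>, moves together with runner \<open>i\<close>, or is its
    mirror image in the arc.\<close>
  consider "u j = 0" | i where "i \<in> I - {j}" "u i = u j" | i where "i \<in> I - {j}" "u i = - u j"
    using rel by (metis abs_eq_iff)
  then show ?thesis
  proof cases
    case 1
    have "v j \<noteq> 0" using pos j by force
    then show ?thesis using 1 \<rho> by (intro ex[of "- x j / v j"] exI[of _ 0]) auto
  next
    case 2
    have "v i \<noteq> v j" using inj 2 j by (auto dest: inj_onD)
    define \<alpha> where "\<alpha> = (x j - x i) / (real_of_int (v i) - real_of_int (v j))"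
    have "\<alpha> * (real_of_int (v i) - real_of_int (v j)) = x j - x i" using \<open>v i \<noteq> v j\<close> by (simp add: \<alpha>_def)
    then have "x j + \<alpha> * real_of_int (v j) = x i + \<alpha> * real_of_int (v i)" by (simp add: algebra_simps)
    then show ?thesis using 2 by (intro ex[of \<alpha>]) (auto dest!: bspec[of _ _ i])
  next
    case 3
    have "v i > 0" "v j > 0" using pos 3 j by auto
    define \<alpha> where "\<alpha> = (\<rho> - x j - x i) / (real_of_int (v i) + real_of_int (v j))"
    have "\<alpha> * (real_of_int (v i) + real_of_int (v j)) = \<rho> - x j - x i"
      using \<open>v i > 0\<close> \<open>v j > 0\<close> by (simp add: \<alpha>_def)
    then have e: "x j + \<alpha> * real_of_int (v j) = \<rho> - (x i + \<alpha> * real_of_int (v i))" by (simp add: algebra_simps)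
    show ?thesis
    proof (rule ex[of \<alpha>])
      fix s assume "\<forall>i\<in>I - {j}. \<exists>c. x i + \<alpha> * real_of_int (v i) + s * real_of_int (u i) - real_of_int c \<in> {0..\<rho>}"
      then obtain c where c: "x i + \<alpha> * real_of_int (v i) + s * real_of_int (u i) - real_of_int c \<in> {0..\<rho>}"
        using 3 by blast
      have "real_of_int (u i) = - real_of_int (u j)" using 3 by simp
      then show "\<exists>c. x j + \<alpha> * real_of_int (v j) + s * real_of_int (u j) - real_of_int c \<in> {0..\<rho>}"
        using c e by (intro exI[of _ "- c"]) auto
    qed
  qed
qed

text \<open>The points \<open>U t\<close> and \<open>U t'\<close> span a segment of the zonotope that absorbs the multiples of \<open>U w\<close>
  modulo \<open>1\<close> once it is scaled by \<open>1 / N\<close>.\<close>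

lemma covering_radius_le_of_segment:
  fixes t t' :: "nat \<Rightarrow> real" and w :: "nat \<Rightarrow> int"
  assumes C: "conjecture_C (n - 1)" and LVP: "LVP n"
    and gen: "LR_generators n v U" and inj: "inj_on (\<lambda>i. v $ i) {..<n}" and N: "N > 0"
    and t: "\<forall>i<n. 0 \<le> t i \<and> t i \<le> 1" and t': "\<forall>i<n. 0 \<le> t' i \<and> t' i \<le> 1"
    and seg: "\<forall>r<n-1. (\<Sum>i<n. real_of_int (U $$ (r, i)) * t i) - (\<Sum>i<n. real_of_int (U $$ (r, i)) * t' i)
      = N * real_of_int (\<Sum>i<n. U $$ (r, i) * w i)"
    and nz: "r0 < n - 1" "(\<Sum>i<n. U $$ (r0, i) * w i) \<noteq> 0"
  shows "covering_radius (n - 1) (zonotope U) \<le> (real n - 2) / real n + 1 / N"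
proof -
  have n: "n \<ge> 2" using nz by linarith
  have U: "U \<in> carrier_mat (n - 1) n" and vc: "v \<in> carrier_vec n" and pos: "\<forall>i<n. v $ i > 0"
    and surj: "{U *\<^sub>v c | c. c \<in> carrier_vec n} = carrier_vec (n - 1)" and Uv0: "U *\<^sub>v v = 0\<^sub>v (n - 1)"
    using gen by (auto simp: LR_generators_def)
  have Uv: "(\<Sum>i<n. U $$ (r, i) * v $ i) = 0" if "r < n - 1" for r
    using mult_mat_vec_index_sum[OF U vc that] Uv0 that by simp
  have UvR: "(\<Sum>i<n. real_of_int (U $$ (r, i)) * real_of_int (v $ i)) = 0" if "r < n - 1" for r
    using arg_cong[OF Uv[OF that], of real_of_int] by simp
  \<comment> \<open>If \<open>w\<close> were proportional to \<open>v\<close>, then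
    \<open>U w\<close> would be a multiple of \<open>U v = 0\<close>.\<close>
  have "\<exists>i0<n. \<exists>j0<n. v $ i0 * w j0 \<noteq> v $ j0 * w i0"
  proof (rule ccontr)
    assume "\<not> ?thesis"
    then have "\<forall>i<n. v $ 0 * w i = v $ i * w 0" using n by auto
    then have "(\<Sum>i<n. U $$ (r0, i) * (v $ 0 * w i)) = (\<Sum>i<n. U $$ (r0, i) * (v $ i * w 0))"
      by (intro sum.cong) auto
    then have "v $ 0 * (\<Sum>i<n. U $$ (r0, i) * w i) = (\<Sum>i<n. U $$ (r0, i) * v $ i) * w 0"
      by (simp add: sum_distrib_left sum_distrib_right algebra_simps)
    then have "v $ 0 = 0" using Uv[OF nz(1)] nz(2) by simp
    then show False using pos n by force
  qed
  then obtain i0 j0 where "i0 < n" "j0 < n" "v $ i0 * w j0 \<noteq> v $ j0 * w i0" by blast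
  from lonely_relation[OF LVP pos inj this] obtain a b j where j: "j < n"
    and ab: "\<forall>l\<in>{..<n}-{j}. a * v $ l + b * w l \<noteq> 0"
      "inj_on (\<lambda>l. \<bar>a * v $ l + b * w l\<bar>) ({..<n}-{j})"
    and rel: "a * v $ j + b * w j = 0 \<or> (\<exists>i\<in>{..<n}-{j}. \<bar>a * v $ i + b * w i\<bar> = \<bar>a * v $ j + b * w j\<bar>)"
    by (elim exE conjE) (rule that)
  \<comment> \<open>As \<open>U v = 0\<close>, a motion along \<open>u\<close> changes the image
    under \<open>U\<close> only by multiples of \<open>U w\<close>.\<close>
  define u where "u = (\<lambda>l. a * v $ l + b * w l)"
  have card: "card ({..<n} - {j}) = n - 1" using j by simp
  then have ne: "{..<n} - {j} \<noteq> {}" using n by (intro notI) simp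
  show ?thesis
  proof (rule field_le_epsilon)
    fix \<epsilon> :: real assume "\<epsilon> > 0"
    obtain \<rho>' where \<rho>': "\<rho>' > 0" "\<rho>' < (real (n - 1) - 1) / (real (n - 1) + 1) + \<epsilon>"
      and meet: "runners_meet ({..<n} - {j}) u \<rho>'"
      using conjecture_C_runners[of "{..<n} - {j}" u \<epsilon>] C ne ab \<open>\<epsilon> > 0\<close> unfolding card u_def by auto
    \<comment> \<open>Room \<open>\<rho>'\<close> for the runners and \<open>1 / N\<close> for the
      segment.\<close>
    define \<rho> where "\<rho> = \<rho>' + 1 / N"
    have \<rho>0: "\<rho> > 0" using \<rho>' N by (simp add: \<rho>_def add_pos_pos)
    have "\<exists>t z. (\<forall>i<n. 0 \<le> t i \<and> t i \<le> 1) \<and>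
       (\<forall>r<n-1. y r = \<rho> * (\<Sum>i<n. real_of_int (U $$ (r, i)) * t i) + real_of_int (z r))" for y
    proof -
      let ?S = "\<lambda>r f. \<Sum>i<n. real_of_int (U $$ (r, i)) * f i"
      have "\<forall>y. \<exists>c. \<forall>r<n-1. (\<Sum>i<n. U $$ (r, i) * c i) = y r"
        using int_mat_surjD[OF U surj] by metis
      \<comment> \<open>The segment scaled by \<open>1 / N\<close> starts at
        \<open>U t' / N\<close>, so this point is subtracted from the target before lifting.\<close>
      from int_surj_real_surj[OF this, of "\<lambda>r. y r - ?S r t' / N"]
      obtain x where x: "\<forall>r<n-1. ?S r x = y r - ?S r t' / N" by blast
      obtain \<alpha> s where "\<forall>i\<in>{..<n}. \<exists>c. x i + \<alpha> * real_of_int (v $ i) + s * real_of_int (u i) - real_of_int c \<in> {0..\<rho>'}"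
        using runners_meet_extend[OF meet _ _ _ inj, of x] \<rho>'(1) j pos rel unfolding u_def by auto
      then obtain c where c: "\<And>i. i < n \<Longrightarrow> x i + \<alpha> * real_of_int (v $ i) + s * real_of_int (u i) - real_of_int (c i) \<in> {0..\<rho>'}"
        by (metis lessThan_iff)
      define \<tau> where "\<tau> = (\<lambda>i. x i + \<alpha> * real_of_int (v $ i) + s * real_of_int (u i) - real_of_int (c i))"
      \<comment> \<open>The motion \<open>s u\<close> leaves the error \<open>s b U w\<close>. An
        integral multiple of \<open>U w\<close> goes into the lattice, and the missing
        \<open>\<theta> U w\<close> comes from the scaled segment, whose endpoints differ by
        \<open>U w\<close>.\<close>
      define \<theta> where "\<theta> = frac (- s * b)"
      have \<theta>: "0 \<le> \<theta>" "\<theta> \<le> 1" using frac_ge_0 frac_lt_1 less_imp_le by (auto simp: \<theta>_def)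
      define f where "f = (\<lambda>i. (\<tau> i + (\<theta> * t i + (1 - \<theta>) * t' i) / N) / \<rho>)"
      have "0 \<le> f i \<and> f i \<le> 1" if "i < n" for i
      proof -
        have 1: "0 \<le> \<tau> i" "\<tau> i \<le> \<rho>'" using c[OF that] by (auto simp: \<tau>_def)
        have 2: "0 \<le> \<theta> * t i + (1 - \<theta>) * t' i" using \<theta> t t' that by simp
        have 3: "\<theta> * t i + (1 - \<theta>) * t' i \<le> 1"
          using convex_bound_le[of "t i" 1 "t' i" \<theta> "1 - \<theta>"] \<theta> t t' that by simp
        have "0 \<le> \<tau> i + (\<theta> * t i + (1 - \<theta>) * t' i) / N" using 1 2 N by simp
        moreover have "\<tau> i + (\<theta> * t i + (1 - \<theta>) * t' i) / N \<le> \<rho>"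
          using 1 3 N unfolding \<rho>_def by (intro add_mono divide_right_mono) auto
        ultimately show ?thesis using \<rho>0 by (simp add: f_def)
      qed
      moreover have "y r = \<rho> * ?S r f + real_of_int (\<Sum>i<n. U $$ (r, i) * (c i + \<lfloor>- s * b\<rfloor> * w i))"
        if r: "r < n - 1" for r
      proof -
        have "\<rho> * ?S r f = (\<Sum>i<n. real_of_int (U $$ (r, i)) * (\<rho> * f i))"
          by (simp add: sum_distrib_left algebra_simps)
        also have "\<dots> = (\<Sum>i<n. real_of_int (U $$ (r, i)) * x i
            + (\<alpha> + s * a) * (real_of_int (U $$ (r, i)) * real_of_int (v $ i))
            + s * b * (real_of_int (U $$ (r, i)) * real_of_int (w i))
            - real_of_int (U $$ (r, i)) * real_of_int (c i)
            + \<theta> / N * (real_of_int (U $$ (r, i)) * t i) + (1 - \<theta>) / N * (real_of_int (U $$ (r, i)) * t' i))"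
          using \<rho>0 N by (intro sum.cong) (simp_all add: f_def \<tau>_def u_def field_simps)
        also have "\<dots> = ?S r x + (\<alpha> + s * a) * ?S r (\<lambda>i. v $ i) + s * b * ?S r w - ?S r c
            + \<theta> / N * ?S r t + (1 - \<theta>) / N * ?S r t'"
          by (simp only: sum.distrib sum_subtractf sum_distrib_left)
        also have "\<dots> = y r + s * b * ?S r w - ?S r c + \<theta> / N * (?S r t - ?S r t')"
          unfolding x[rule_format, OF r] UvR[OF r] by (simp add: diff_divide_distrib algebra_simps)
        also have "\<dots> = y r + s * b * ?S r w - ?S r c + \<theta> * ?S r w"
          using seg r N by simp
        finally have 1: "\<rho> * ?S r f = y r - ?S r c + (s * b + \<theta>) * ?S r w" by (simp add: algebra_simps)
        have 2: "s * b + \<theta> = - real_of_int \<lfloor>- s * b\<rfloor>" by (simp add: \<theta>_def frac_def)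
        have "real_of_int (\<Sum>i<n. U $$ (r, i) * (c i + \<lfloor>- s * b\<rfloor> * w i))
          = ?S r c + real_of_int \<lfloor>- s * b\<rfloor> * ?S r w"
          by (simp add: sum.distrib sum_distrib_left algebra_simps)
        then show ?thesis using 1 unfolding 2 by simp
      qed
      ultimately show ?thesis
        by (intro exI[of _ f] exI[of _ "\<lambda>r. \<Sum>i<n. U $$ (r, i) * (c i + \<lfloor>- s * b\<rfloor> * w i)"] conjI allI impI) blast+
    qed
    then have "covering_radius (n - 1) (zonotope U) \<le> \<rho>"
      using translates_cover_iff[OF U, of \<rho>] by (intro covering_radius_le \<rho>0) simp
    \<comment> \<open>For \<open>n - 1\<close> runners the bound of Conjecture C reads
      \<open>((n - 1) - 1) / ((n - 1) + 1) = (n - 2) / n\<close>.\<close>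
    also have "\<rho> \<le> (real n - 2) / real n + 1 / N + \<epsilon>"
      using \<rho>'(2) n by (simp add: \<rho>_def of_nat_diff)
    finally show "covering_radius (n - 1) (zonotope U) \<le> (real n - 2) / real n + 1 / N + \<epsilon>" .
  qed
qed

section \<open>Counting lattice points modulo \<open>N\<close>\<close>

text \<open>Pigeonhole: reduction modulo \<open>N\<close> is injective on \<open>E\<close> and takes
  at most \<open>N ^ d\<close> values.\<close>

lemma card_int_points_le_of_inj_mod:
  fixes N :: nat
  assumes "N > 0" "E \<subseteq> int_points d"
    and inj: "\<And>x y. x \<in> E \<Longrightarrow> y \<in> E \<Longrightarrow> (\<And>r. r < d \<Longrightarrow> \<exists>z. x $ r - y $ r = real N * real_of_int z) \<Longrightarrow> x = y"
  shows "finite E \<and> card E \<le> N ^ d"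
proof -
  \<comment> \<open>\<open>restrict\<close> makes the residue vectors extensional, so that they lie
    in a finite \<open>PiE\<close>.\<close>
  define f where "f = (\<lambda>x :: real vec. restrict (\<lambda>i. \<lfloor>x $ i\<rfloor> mod int N) {..<d})"
  have "inj_on f E"
  proof (rule inj_onI)
    fix x y assume xy: "x \<in> E" "y \<in> E" "f x = f y"
    show "x = y"
    proof (rule inj[OF xy(1,2)])
      fix r assume r: "r < d"
      have "\<lfloor>x $ r\<rfloor> mod int N = \<lfloor>y $ r\<rfloor> mod int N"
        using fun_cong[OF xy(3), of r] r by (simp add: f_def)
      then have "int N dvd \<lfloor>x $ r\<rfloor> - \<lfloor>y $ r\<rfloor>" by (simp add: mod_eq_dvd_iff)
      then obtain k where "\<lfloor>x $ r\<rfloor> - \<lfloor>y $ r\<rfloor> = int N * k" ..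
      moreover have "x $ r = real_of_int \<lfloor>x $ r\<rfloor>" "y $ r = real_of_int \<lfloor>y $ r\<rfloor>"
        using xy assms(2) r by (auto simp: int_points_def Ints_def subset_iff)
      ultimately have "x $ r - y $ r = real N * real_of_int k"
        by (metis of_int_diff of_int_mult of_int_of_nat_eq)
      then show "\<exists>z. x $ r - y $ r = real N * real_of_int z" by blast
    qed
  qed
  moreover have "f ` E \<subseteq> {..<d} \<rightarrow>\<^sub>E {0..<int N}" using assms(1) by (auto simp: f_def simp del: restrict_apply intro!: restrict_PiE_iff[THEN iffD2])
  moreover have "finite ({..<d} \<rightarrow>\<^sub>E {0..<int N})" by (intro finite_PiE) auto
  ultimately have "finite E" "card E \<le> card ({..<d} \<rightarrow>\<^sub>E {0..<int N})"
    by (auto intro: inj_on_finite card_inj_on_le)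
  then show ?thesis by (simp add: card_PiE)
qed

theorem theorem2:
  fixes n :: nat
  assumes "n \<ge> 1"
    and "conjecture_C (n - 1)"
    and "\<And>k. k \<le> n \<Longrightarrow> LVP k"
    and "strong_LR_zonotope n Z"
    and "covering_radius (n - 1) Z > (real n - 1) / (real n + 1)"
  shows "finite (Z \<inter> int_points (n - 1)) \<and>
         card (Z \<inter> int_points (n - 1)) \<le> ((n + 1) choose 2) ^ (n - 1)"
proof -
  obtain v U where gen: "LR_generators n v U" and inj: "inj_on (\<lambda>i. v $ i) {..<n}" and Z: "Z = zonotope U"
    using assms(4) by (auto simp: strong_LR_zonotope_def)
  have U: "U \<in> carrier_mat (n - 1) n" and surj: "{U *\<^sub>v c | c. c \<in> carrier_vec n} = carrier_vec (n - 1)"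
    using gen by (auto simp: LR_generators_def)
  define N where "N = (n + 1) choose 2"
  have N0: "N > 0" using assms(1) by (simp add: N_def)
  have "2 * N = n * (n + 1)" by (simp add: N_def choose_two)
  then have N2: "real N = real n * (real n + 1) / 2"
    by (metis (no_types) nonzero_mult_div_cancel_left of_nat_1 of_nat_add of_nat_mult of_nat_numeral zero_neq_numeral)
  have zon: "\<exists>t. (\<forall>i<n. 0 \<le> t i \<and> t i \<le> 1) \<and> (\<forall>r<n-1. x $ r = (\<Sum>i<n. real_of_int (U $$ (r, i)) * t i))"
    if x: "x \<in> Z" for x
  proof -
    obtain t where t: "t \<in> carrier_vec n" "\<forall>i<n. 0 \<le> t $ i \<and> t $ i \<le> 1" "x = map_mat real_of_int U *\<^sub>v t"
      using x U by (auto simp: Z zonotope_def)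
    have "map_mat real_of_int U \<in> carrier_mat (n - 1) n" using U by auto
    from mult_mat_vec_index_sum[OF this t(1)] have "\<forall>r<n-1. x $ r = (\<Sum>i<n. real_of_int (U $$ (r, i)) * t $ i)"
      using U t(3) by auto
    then show ?thesis using t(2) by (intro exI[of _ "\<lambda>i. t $ i"]) auto
  qed
  \<comment> \<open>Distinct lattice points of \<open>Z\<close> congruent modulo \<open>N\<close>
    would span a segment \<open>N z\<close> with \<open>z\<close> a nonzero lattice vector, and the
    covering radius would obey the bound after all.\<close>
  have "x = y" if x: "x \<in> Z \<inter> int_points (n - 1)" and y: "y \<in> Z \<inter> int_points (n - 1)"
    and cong: "\<And>r. r < n - 1 \<Longrightarrow> \<exists>z. x $ r - y $ r = real N * real_of_int z" for x y
  proof (rule ccontr)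
    assume "x \<noteq> y"
    then obtain r0 where r0: "r0 < n - 1" "x $ r0 \<noteq> y $ r0"
      using x y eq_vecI[of x y] by (fastforce simp: int_points_def)
    obtain z where z: "\<And>r. r < n - 1 \<Longrightarrow> x $ r - y $ r = real N * real_of_int (z r)" using cong by metis
    obtain w where w: "\<forall>r<n-1. (\<Sum>i<n. U $$ (r, i) * w i) = z r" using int_mat_surjD[OF U surj] by metis
    obtain t where t: "\<forall>i<n. 0 \<le> t i \<and> t i \<le> 1" "\<forall>r<n-1. x $ r = (\<Sum>i<n. real_of_int (U $$ (r, i)) * t i)"
      using zon[of x] x by blast
    obtain t' where t': "\<forall>i<n. 0 \<le> t' i \<and> t' i \<le> 1" "\<forall>r<n-1. y $ r = (\<Sum>i<n. real_of_int (U $$ (r, i)) * t' i)"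
      using zon[of y] y by blast
    have "covering_radius (n - 1) (zonotope U) \<le> (real n - 2) / real n + 1 / real N"
    proof (rule covering_radius_le_of_segment[OF assms(2) assms(3)[OF order_refl] gen inj _ t(1) t'(1)])
      show "(\<Sum>i<n. U $$ (r0, i) * w i) \<noteq> 0" using w z[OF r0(1)] r0 by auto
      show "\<forall>r<n-1. (\<Sum>i<n. real_of_int (U $$ (r, i)) * t i) - (\<Sum>i<n. real_of_int (U $$ (r, i)) * t' i)
        = real N * real_of_int (\<Sum>i<n. U $$ (r, i) * w i)"
        using t(2) t'(2) w z by simp
    qed (use N0 r0 in auto)
    \<comment> \<open>Since \<open>1 / N = 2 / (n (n + 1))\<close>, the numerator over
      \<open>n (n + 1)\<close> is \<open>(n - 2) (n + 1) + 2 = n (n - 1)\<close>. This identity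
      dictates the value of \<open>N\<close>.\<close>
    also have "(real n - 2) / real n + 1 / real N = (real n - 1) / (real n + 1)"
    proof -
      have "real n > 0" "real n + 1 > 0" using assms(1) by auto
      then show ?thesis unfolding N2 by (simp add: divide_simps) (simp add: algebra_simps)
    qed
    finally show False using assms(5) Z by simp
  qed
  then show ?thesis
    using card_int_points_le_of_inj_mod[OF N0, of "Z \<inter> int_points (n - 1)" "n - 1"] unfolding N_def by blast
qed

end
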